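(* Consider the system $\dot x=f(x)$, $y=h(x)$ with $x\in\mathbb{R}^n$, $y\in\mathbb{R}^q$, and let $\mathcal{A}\subseteq\mathbb{R}^n$ be a bounded set. Assume that the "converging observer" Assumption $\mathbb{A}$ (recalled in the context) holds with the open set $\mathcal{O}\supseteq\mathcal{A}$, the $C^1$ injective immersion $\tau^*:\mathcal{O}\to\mathbb{R}^m$ and the set $\mathcal{T}$ of pairs $(\varphi,\tau)$. Assume moreover that there exist an open subset $\mathcal{O}_a$ of $\mathbb{R}^m=\mathbb{R}^n\times\mathbb{R}^{m-n}$ containing the closure of $\mathcal{A}\times\{0\}$ and a diffeomorphism $\tau_e^*:\mathcal{O}_a\to\mathbb{R}^m$ satisfying $$\tau_e^*(x,0)=\tau^*(x)\quad\forall x\in\mathcal{A},\qquad \tau_e^*(\mathcal{O}_a)=\mathbb{R}^m,$$ and such that, letting $\tau_{ex}:\mathbb{R}^m\to\mathbb{R}^n$ denote the $x$-component of the inverse of $\tau_e^*$, there exists a function $\varphi$ such that the pair $(\varphi,\tau_{ex})$ belongs to $\mathcal{T}$. Then, for any $x_0\in\mathcal{A}$ such that the solution $X(x_0,t)$ of $\dot x=f(x)$ is defined and remains in $\mathcal{A}$ for all $t\in[0,+\infty)$, and for any $(\hat x_0,\hat w_0)\in\mathcal{O}_a$, the solution $(X(x_0,t),\hat X(\hat x_0,\hat w_0,t;y_{x_0}),\hat W(\hat x_0,\hat w_0,t;y_{x_0}))$, with initial condition $(x_0,\hat x_0,\hat w_0)$ at time $0$, of the cascade of the system $\dot x=f(x)$,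 $y=h(x)$ with the observer $$\frac{d}{dt}\begin{pmatrix}\hat x\\ \hat w\end{pmatrix}=\left(\frac{\partial\tau_e^*}{\partial(\hat x,\hat w)}(\hat x,\hat w)\right)^{-1}\varphi\big(\tau_e^*(\hat x,\hat w),\hat x,y\big)$$ is also defined on $[0,+\infty)$ and satisfies $$\lim_{t\to+\infty}\Big(\big|\hat W(\hat x_0,\hat w_0,t;y_{x_0})\big|+\big|X(x_0,t)-\hat X(\hat x_0,\hat w_0,t;y_{x_0})\big|\Big)=0.$$
   Context: $X(x_0,t)$ denotes the solution at time $t$ of $\dot x=f(x)$ with initial condition $x_0$ at time $0$, and $y_{x_0}(t)=h(X(x_0,t))$ the corresponding output. A diffeomorphism $\mathcal{O}_a\to\mathbb{R}^m$ means a $C^1$ diffeomorphism onto its image. The observer state $(\hat x,\hat w)$ takes values in $\mathcal{O}_a\subseteq\mathbb{R}^n\times\mathbb{R}^{m-n}$ ($m\ge n$). Assumption $\mathbb{A}$ (converging observer): there exist an open subset $\mathcal{O}$ of $\mathbb{R}^n$ containing $\mathcal{A}$, a $C^1$ injective immersion $\tau^*:\mathcal{O}\to\mathbb{R}^m$, and a set $\mathcal{T}$ of pairs $(\varphi,\tau)$ of locally Lipschitz functions ($\varphi:\mathbb{R}^m\times\mathbb{R}^n\times\mathbb{R}^q\to\mathbb{R}^m$, $\tau:\mathbb{R}^m\to\mathbb{R}^n$) such that for every pair $(\varphi,\tau)\in\mathcal{T}$: (i) $\tau(\tau^*(x))=x$ for all $x\in\mathcal{A}$; and (ii) for any solution $X(x_0,t)$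 of $\dot x=f(x)$ which is defined and remains in $\mathcal{A}$ for $t\in[0,+\infty)$, the solution $(X(x_0,t),\hat\Xi(\hat\xi_0,t;y_{x_0}))$ of the cascade system $$\dot x=f(x),\quad y=h(x),\quad \dot{\hat\xi}=\varphi(\hat\xi,\hat x,y),\quad \hat x=\tau(\hat\xi),$$ with initial condition $(x_0,\hat\xi_0)\in\mathcal{A}\times\mathbb{R}^m$ at time $0$, is also defined on $[0,+\infty)$ and satisfies $\lim_{t\to+\infty}|\hat\Xi(\hat\xi_0,t;y_{x_0})-\tau^*(X(x_0,t))|=0$. *)

theory Defs
  imports "HOL-Analysis.Analysis"
begin

(* The decomposition R^m = R^n x R^(m-n) is given by an injection e of the n coordinate indices
   into the m coordinate indices: the x-coordinates of v are those with index in range e, the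
   w-coordinates are the remaining ones.  Index types are nonempty, so a product with a type
   real^'k would rule out m = n. *)

definition x_part :: "('n \<Rightarrow> 'm) \<Rightarrow> real^'m \<Rightarrow> real^'n"
  where "x_part e v = (\<chi> i. v $ e i)"

(* Keeps the w-coordinates in place and sets the x-coordinates to 0, so that its Euclidean norm
   is the norm of w in R^(m-n). *)
definition w_part :: "('n \<Rightarrow> 'm) \<Rightarrow> real^'m \<Rightarrow> real^'m"
  where "w_part e v = (\<chi> j. if j \<in> range e then 0 else v $ j)"

(* x maps to (x, 0) *)
definition x_embed :: "('n \<Rightarrow> 'm) \<Rightarrow> real^'n \<Rightarrow> real^'m"
  where "x_embed e x = (\<chi> j. if j \<in> range e then x $ inv e j else 0)"

lemma x_part_x_embed: "inj e \<Longrightarrow> x_part e (x_embed e x) = x"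
  by (simp add: x_part_def x_embed_def)

lemma w_part_x_embed: "w_part e (x_embed e x) = 0"
  by (simp add: w_part_def x_embed_def vec_eq_iff)

lemma x_embed_plus_w_part: "inj e \<Longrightarrow> x_embed e (x_part e v) + w_part e v = v"
  by (auto simp: x_part_def x_embed_def w_part_def vec_eq_iff)

definition locally_lipschitz :: "('a::metric_space \<Rightarrow> 'b::metric_space) \<Rightarrow> bool"
  where "locally_lipschitz g \<longleftrightarrow> (\<forall>x. \<exists>u>0. \<exists>L. L-lipschitz_on (cball x u) g)"

definition C1_on :: "'a set \<Rightarrow> ('a::real_normed_vector \<Rightarrow> 'b::real_normed_vector) \<Rightarrow> bool"
  where "C1_on S g \<longleftrightarrow>
    (\<exists>g' :: 'a \<Rightarrow> 'a \<Rightarrow>\<^sub>L 'b.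
       (\<forall>x\<in>S. (g has_derivative blinfun_apply (g' x)) (at x)) \<and> continuous_on S g')"

definition C1_injective_immersion ::
    "'a set \<Rightarrow> ('a::real_normed_vector \<Rightarrow> 'b::real_normed_vector) \<Rightarrow> bool"
  where "C1_injective_immersion S g \<longleftrightarrow>
    C1_on S g \<and> inj_on g S \<and> (\<forall>x\<in>S. inj (frechet_derivative g (at x)))"

definition C1_diffeo_onto_image ::
    "'a set \<Rightarrow> ('a::real_normed_vector \<Rightarrow> 'b::real_normed_vector) \<Rightarrow> bool"
  where "C1_diffeo_onto_image S g \<longleftrightarrow>
    open (g ` S) \<and> inj_on g S \<and> C1_on S g \<and> C1_on (g ` S) (the_inv_into S g)"

(* z is a solution of z' = F(z) on the time interval J, with state space D *)
definition solves ::
    "('a::real_normed_vector \<Rightarrow> 'a) \<Rightarrow> 'a set \<Rightarrow> real set \<Rightarrow> (real \<Rightarrow> 'a) \<Rightarrow> bool"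
  where "solves F D J z \<longleftrightarrow>
    (\<forall>t\<in>J. z t \<in> D \<and> (z has_vector_derivative F (z t)) (at t within J))"

(* vector field of the cascade x' = f(x), z' = g(x, z) *)
definition cascade_field ::
    "('a \<Rightarrow> 'a) \<Rightarrow> ('a \<Rightarrow> 'b \<Rightarrow> 'b) \<Rightarrow> 'a \<times> 'b \<Rightarrow> 'a \<times> 'b"
  where "cascade_field f g = (\<lambda>(x, z). (f x, g x z))"

(* For a given solution X of x' = f(x) on [0, oo), (X, Z) is "the" solution of the cascade with
   Z(0) = z0 and it is defined on [0, oo), where the z-component has state space D: it is a
   solution there, and a solution (X, Z') on any interval [0, T) with Z'(0) = z0 coincides with
   it.  The last clause spells out the definite article; for the field
   phi(xi, tau(xi), h(x)) with phi, tau locally Lipschitz it holds automatically when h is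
   continuous. *)
definition global_cascade_solution ::
    "('a::real_normed_vector \<Rightarrow> 'a) \<Rightarrow> ('a \<Rightarrow> 'b::real_normed_vector \<Rightarrow> 'b) \<Rightarrow> 'b set
       \<Rightarrow> (real \<Rightarrow> 'a) \<Rightarrow> 'b \<Rightarrow> (real \<Rightarrow> 'b) \<Rightarrow> bool"
  where "global_cascade_solution f g D X z0 Z \<longleftrightarrow>
    Z 0 = z0 \<and>
    solves (cascade_field f g) (UNIV \<times> D) {0..} (\<lambda>t. (X t, Z t)) \<and>
    (\<forall>T Z'. Z' 0 = z0 \<and> solves (cascade_field f g) (UNIV \<times> D) {0..<T} (\<lambda>t. (X t, Z' t))
       \<longrightarrow> (\<forall>t\<in>{0..<T}. Z' t = Z t))"

(* xi' = phi(xi, xhat, y) with xhat = tau(xi), y = h(x) *)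
definition observer_field ::
    "('x \<Rightarrow> 'y) \<Rightarrow> ('z \<times> 'x \<times> 'y \<Rightarrow> 'z) \<Rightarrow> ('z \<Rightarrow> 'x) \<Rightarrow> 'x \<Rightarrow> 'z \<Rightarrow> 'z"
  where "observer_field h \<phi> \<tau> x \<xi> = \<phi> (\<xi>, \<tau> \<xi>, h x)"

definition converging_observer ::
    "(real^'n \<Rightarrow> real^'n) \<Rightarrow> (real^'n \<Rightarrow> real^'q) \<Rightarrow> (real^'n) set \<Rightarrow> (real^'n) set
       \<Rightarrow> (real^'n \<Rightarrow> real^'m)
       \<Rightarrow> (((real^'m) \<times> (real^'n) \<times> (real^'q) \<Rightarrow> real^'m) \<times> (real^'m \<Rightarrow> real^'n)) set \<Rightarrow> bool"
  where "converging_observer f h A Op \<tau>s \<T> \<longleftrightarrow>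
    open Op \<and> A \<subseteq> Op \<and> C1_injective_immersion Op \<tau>s \<and>
    (\<forall>(\<phi>, \<tau>)\<in>\<T>.
       locally_lipschitz \<phi> \<and> locally_lipschitz \<tau> \<and>
       (\<forall>x\<in>A. \<tau> (\<tau>s x) = x) \<and>
       (\<forall>x0\<in>A. \<forall>X. X 0 = x0 \<and> solves f UNIV {0..} X \<and> (\<forall>t\<ge>0. X t \<in> A) \<longrightarrow>
          (\<forall>\<xi>0. \<exists>\<Xi>. global_cascade_solution f (observer_field h \<phi> \<tau>) UNIV X \<xi>0 \<Xi> \<and>
             ((\<lambda>t. norm (\<Xi> t - \<tau>s (X t))) \<longlongrightarrow> 0) at_top)))"

(* The observer written in the coordinates z = (xhat, what):
   z' = (d taue / dz (z))^(-1) phi(taue(z), xhat, y) *)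
definition lifted_observer_field ::
    "('n \<Rightarrow> 'm) \<Rightarrow> (real^'n \<Rightarrow> real^'q) \<Rightarrow> ((real^'m) \<times> (real^'n) \<times> (real^'q) \<Rightarrow> real^'m)
       \<Rightarrow> (real^'m \<Rightarrow> real^'m) \<Rightarrow> real^'n \<Rightarrow> real^'m \<Rightarrow> real^'m"
  where "lifted_observer_field e h \<phi> \<tau>e x z =
    matrix_inv (jacobian \<tau>e (at z)) *v \<phi> (\<tau>e z, x_part e z, h x)"

end

(* The observer in the coordinates z is the pull-back by \<tau>e of the observer in the coordinates \<xi>,
   and \<tau>e maps Oa onto the whole space; so Z is the inverse image of the solution \<Xi>, which is
   defined for all times, and uniqueness is transported in the other direction.  The distance
   between \<Xi> and the compact set \<tau>e(closure (A x 0)) tends to 0, and the inverse of \<tau>e is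
   uniformly continuous near that set; hence Z(t) - (X(t), 0) tends to 0. *)

theory Submission
  imports Defs
begin

lemma bounded_linear_x_part: "bounded_linear (x_part e)"
  unfolding linear_conv_bounded_linear[symmetric]
  by (rule linearI) (auto simp: x_part_def vec_eq_iff)

lemma bounded_linear_w_part: "bounded_linear (w_part e)"
  unfolding linear_conv_bounded_linear[symmetric]
  by (rule linearI) (auto simp: w_part_def vec_eq_iff)

lemma bounded_linear_x_embed: "bounded_linear (x_embed e)"
  unfolding linear_conv_bounded_linear[symmetric]
  by (rule linearI) (auto simp: x_embed_def vec_eq_iff)

lemma C1_on_imp_continuous_on: "C1_on S g \<Longrightarrow> continuous_on S g"
  unfolding C1_on_def
  by (blast intro: continuous_at_imp_continuous_on has_derivative_continuous)

text \<open>The x-equation does not involve z, so the cascade splits into components. This lets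
  \<open>X\<close> act as a fixed input while observers in two coordinate systems are
  compared.\<close>

lemma solves_cascade_iff:
  "solves (cascade_field f g) (UNIV \<times> D) J (\<lambda>t. (X t, Z t)) \<longleftrightarrow>
     solves f UNIV J X \<and>
     (\<forall>t\<in>J. Z t \<in> D \<and> (Z has_vector_derivative g (X t) (Z t)) (at t within J))"
proof -
  have "((\<lambda>t. (X t, Z t)) has_vector_derivative (a, b)) (at t within J) \<longleftrightarrow>
      (X has_vector_derivative a) (at t within J) \<and> (Z has_vector_derivative b) (at t within J)" for a b t
  proof
    assume P: "((\<lambda>t. (X t, Z t)) has_vector_derivative (a, b)) (at t within J)"
    show "(X has_vector_derivative a) (at t within J) \<and> (Z has_vector_derivative b) (at t within J)"
      using bounded_linear.has_vector_derivative[OF bounded_linear_fst P]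
        bounded_linear.has_vector_derivative[OF bounded_linear_snd P] by simp
  qed (auto intro: has_vector_derivative_Pair)
  then show ?thesis
    by (auto simp: solves_def cascade_field_def)
qed

text \<open>Chain rule along a curve whose derivative is taken relative to \<open>J\<close>, hence
  may be one-sided at the initial time.\<close>

lemma has_vector_derivative_compose_has_derivative:
  assumes "(Z has_vector_derivative v) (at t within J)"
    and "(g has_derivative g') (at (Z t))"
  shows "((\<lambda>s. g (Z s)) has_vector_derivative g' v) (at t within J)"
proof -
  interpret bounded_linear g' using assms(2) by (rule has_derivative_bounded_linear)
  have "((\<lambda>s. g (Z s)) has_derivative (\<lambda>s. g' (s *\<^sub>R v))) (at t within J)"
    using has_derivative_compose[OF assms(1)[unfolded has_vector_derivative_def] assms(2)] .
  then show ?thesis by (simp add: has_vector_derivative_def scaleR)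
qed

text \<open>Identifies the derivative of the inverse map with the matrix factor of the lifted
  observer. Differentiating \<open>the_inv_into S g (g x) = x\<close> gives a left inverse of the
  Jacobian; for a square matrix it is also a right inverse.\<close>

lemma diffeo_derivatives:
  fixes g :: "real^'m \<Rightarrow> real^'m"
  assumes "C1_diffeo_onto_image S g" and "open S" and "z \<in> S"
  shows "(g has_derivative (*v) (jacobian g (at z))) (at z)"
    and "(the_inv_into S g has_derivative (*v) (matrix_inv (jacobian g (at z)))) (at (g z))"
    and "jacobian g (at z) ** matrix_inv (jacobian g (at z)) = mat 1"
proof -
  have inj: "inj_on g S" and C: "C1_on S g" "C1_on (g ` S) (the_inv_into S g)"
    using assms(1) by (auto simp: C1_diffeo_onto_image_def)
  obtain D where D: "(g has_derivative D) (at z)"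
    using C(1) \<open>z \<in> S\<close> unfolding C1_on_def by blast
  obtain E where E: "(the_inv_into S g has_derivative E) (at (g z))"
    using C(2) \<open>z \<in> S\<close> unfolding C1_on_def by blast
  have lin: "linear D" "linear E"
    using D E by (auto dest: has_derivative_linear)
  have "((\<lambda>x. the_inv_into S g (g x)) has_derivative (\<lambda>x. E (D x))) (at z)"
    using has_derivative_compose[OF D E] .
  \<comment> \<open>The inverse relation is known on \<open>S\<close>, and openness of
    \<open>S\<close> makes that enough for the derivative at \<open>z\<close>.\<close>
  moreover have "((\<lambda>x. the_inv_into S g (g x)) has_derivative (\<lambda>x. x)) (at z)"
    by (rule has_derivative_transform_within_open[OF has_derivative_ident \<open>open S\<close> \<open>z \<in> S\<close>])
      (simp add: the_inv_into_f_f[OF inj])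
  ultimately have "E \<circ> D = id"
    unfolding o_def id_def by (rule has_derivative_unique)
  then have "matrix E ** matrix D = mat 1"
    using matrix_compose[OF lin] by (simp add: matrix_id_mat_1)
  moreover have J: "jacobian g (at z) = matrix D"
    using frechet_derivative_at[OF D] by (simp add: jacobian_def)
  ultimately have inv: "jacobian g (at z) ** matrix E = mat 1" "matrix E ** jacobian g (at z) = mat 1"
    using matrix_left_right_inverse by auto
  \<comment> \<open>\<open>matrix_inv\<close> chooses some two-sided inverse, so existence must come
    first; uniqueness of inverses then gives \<open>matrix E\<close>.\<close>
  have "\<exists>B. jacobian g (at z) ** B = mat 1 \<and> B ** jacobian g (at z) = mat 1"
    using inv by blast
  then show 1: "jacobian g (at z) ** matrix_inv (jacobian g (at z)) = mat 1"
    unfolding matrix_inv_def by (rule someI2_ex) simp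
  have "matrix_inv (jacobian g (at z)) = matrix E"
    by (metis 1 inv(2) matrix_mul_assoc matrix_mul_lid matrix_mul_rid)
  then show "(the_inv_into S g has_derivative (*v) (matrix_inv (jacobian g (at z)))) (at (g z))"
    using E lin(2) by (simp add: matrix_works)
  show "(g has_derivative (*v) (jacobian g (at z))) (at z)"
    using D lin(1) by (simp add: J matrix_works)
qed

text \<open>\<open>y\<close> need not converge, so continuity at a single limit point is not enough:
  a modulus uniform over \<open>K\<close> is required, and \<open>x\<close> may lie outside
  \<open>K\<close>.\<close>

lemma tendsto_compose_diff_compact:
  fixes g :: "'a::euclidean_space \<Rightarrow> 'b::real_normed_vector"
  assumes "continuous_on UNIV g" and "compact K"
    and K: "\<forall>\<^sub>F t in F. y t \<in> K"
    and lim: "((\<lambda>t. norm (x t - y t)) \<longlongrightarrow> 0) F"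
  shows "((\<lambda>t. g (x t) - g (y t)) \<longlongrightarrow> 0) F"
proof (rule tendstoI)
  fix r :: real assume "r > 0"
  \<comment> \<open>The closed 1-neighbourhood of \<open>K\<close>, compact in finite dimension.
    Below, the bound 1 in \<open>min d 1\<close> puts \<open>x t\<close> into \<open>L\<close> and
    the bound \<open>d\<close> serves uniform continuity.\<close>
  define L where "L = {a + b |a b. a \<in> K \<and> b \<in> cball 0 1}"
  have "compact L"
    unfolding L_def using \<open>compact K\<close> by (intro compact_sums) auto
  then have "uniformly_continuous_on L g"
    using assms(1) by (intro compact_uniformly_continuous) (auto intro: continuous_on_subset)
  then obtain d where "d > 0" and d: "\<And>a b. a \<in> L \<Longrightarrow> b \<in> L \<Longrightarrow> dist b a < d \<Longrightarrow> dist (g b) (g a) < r"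
    using \<open>r > 0\<close> unfolding uniformly_continuous_on_def by metis
  have "\<forall>\<^sub>F t in F. norm (x t - y t) < min d 1"
    using order_tendstoD(2)[OF lim, of "min d 1"] \<open>d > 0\<close> by simp
  with K show "\<forall>\<^sub>F t in F. dist (g (x t) - g (y t)) 0 < r"
  proof eventually_elim
    case (elim t)
    have "y t + b \<in> L" if "norm b \<le> 1" for b
      unfolding L_def using elim that by auto
    from this[of 0] this[of "x t - y t"] elim have "y t \<in> L" "x t \<in> L" by simp_all
    then have "dist (g (x t)) (g (y t)) < r"
      using elim by (intro d) (auto simp: dist_norm)
    then show ?case by (simp add: dist_norm)
  qed
qed

text \<open>The two observers are the same vector field in different coordinates. As
  \<open>\<tau>e\<close> is onto, \<open>\<sigma>\<close> is defined along all of
  \<open>\<Xi>\<close>, so the pulled-back solution cannot leave \<open>Oa\<close> in finite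
  time.\<close>

lemma global_cascade_solution_pullback:
  fixes \<tau>e :: "real^'m \<Rightarrow> real^'m" and e :: "'n::finite \<Rightarrow> 'm"
    and Oa :: "(real^'m) set"
  defines "\<sigma> \<equiv> the_inv_into Oa \<tau>e"
  assumes "open Oa" and diffeo: "C1_diffeo_onto_image Oa \<tau>e" and onto: "\<tau>e ` Oa = UNIV"
    and "z0 \<in> Oa"
    and \<Xi>: "global_cascade_solution f (observer_field h \<phi> (\<lambda>\<xi>. x_part e (\<sigma> \<xi>))) UNIV X (\<tau>e z0) \<Xi>"
  shows "global_cascade_solution f (lifted_observer_field e h \<phi> \<tau>e) Oa X z0 (\<lambda>t. \<sigma> (\<Xi> t))"
proof -
  have inj: "inj_on \<tau>e Oa"
    using diffeo by (simp add: C1_diffeo_onto_image_def)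
  have \<tau>\<sigma>: "\<tau>e (\<sigma> \<xi>) = \<xi>" for \<xi>
    unfolding \<sigma>_def by (rule f_the_inv_into_f[OF inj]) (simp add: onto)
  have \<sigma>\<tau>: "\<sigma> (\<tau>e z) = z" if "z \<in> Oa" for z
    unfolding \<sigma>_def by (rule the_inv_into_f_f[OF inj that])
  have \<sigma>_in: "\<sigma> \<xi> \<in> Oa" for \<xi>
    unfolding \<sigma>_def by (rule the_inv_into_into[OF inj]) (simp_all add: onto)
  note der = diffeo_derivatives[OF diffeo \<open>open Oa\<close>, folded \<sigma>_def]
  have sol: "solves f UNIV {0..} X"
    and \<Xi>0: "\<Xi> 0 = \<tau>e z0"
    and \<Xi>': "\<And>t. t \<ge> 0 \<Longrightarrow> (\<Xi> has_vector_derivative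
        observer_field h \<phi> (\<lambda>\<xi>. x_part e (\<sigma> \<xi>)) (X t) (\<Xi> t)) (at t within {0..})"
    and uniq: "\<And>T \<Xi>' t. \<lbrakk>\<Xi>' 0 = \<tau>e z0; solves f UNIV {0..<T} X;
        \<And>t. t \<in> {0..<T} \<Longrightarrow> (\<Xi>' has_vector_derivative
          observer_field h \<phi> (\<lambda>\<xi>. x_part e (\<sigma> \<xi>)) (X t) (\<Xi>' t)) (at t within {0..<T});
        t \<in> {0..<T}\<rbrakk> \<Longrightarrow> \<Xi>' t = \<Xi> t"
    using \<Xi> unfolding global_cascade_solution_def solves_cascade_iff by (simp, simp, simp, blast)
  \<comment> \<open>\<open>der(2)\<close> is used at the point \<open>\<sigma> (\<Xi> t)\<close>,
    whose image under \<open>\<tau>e\<close> is \<open>\<Xi> t\<close>.\<close>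
  have "((\<lambda>t. \<sigma> (\<Xi> t)) has_vector_derivative lifted_observer_field e h \<phi> \<tau>e (X t) (\<sigma> (\<Xi> t)))
      (at t within {0..})" if "t \<ge> 0" for t
    using has_vector_derivative_compose_has_derivative[OF \<Xi>'[OF that] der(2)[OF \<sigma>_in, unfolded \<tau>\<sigma>]]
    by (simp add: observer_field_def lifted_observer_field_def \<tau>\<sigma>)
  \<comment> \<open>A competitor \<open>Z'\<close> is pushed forward by \<open>\<tau>e\<close>: the
    Jacobian cancels its inverse by \<open>der(3)\<close>, so uniqueness of \<open>\<Xi>\<close>
    applies. Applying \<open>\<sigma>\<close> returns to \<open>Z'\<close>, which stays in
    \<open>Oa\<close>.\<close>
  moreover have "Z' t = \<sigma> (\<Xi> t)"
    if Z'0: "Z' 0 = z0" and solX: "solves f UNIV {0..<T} X" and t: "t \<in> {0..<T}"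
      and Z': "\<forall>t\<in>{0..<T}. Z' t \<in> Oa \<and> (Z' has_vector_derivative
        lifted_observer_field e h \<phi> \<tau>e (X t) (Z' t)) (at t within {0..<T})"
    for Z' T t
  proof -
    have "((\<lambda>s. \<tau>e (Z' s)) has_vector_derivative
        observer_field h \<phi> (\<lambda>\<xi>. x_part e (\<sigma> \<xi>)) (X s) (\<tau>e (Z' s))) (at s within {0..<T})"
      if "s \<in> {0..<T}" for s
    proof -
      have s: "Z' s \<in> Oa" "(Z' has_vector_derivative
          lifted_observer_field e h \<phi> \<tau>e (X s) (Z' s)) (at s within {0..<T})"
        using Z' that by auto
      show ?thesis
        using has_vector_derivative_compose_has_derivative[OF s(2) der(1)[OF s(1)]] s(1)
        by (simp add: observer_field_def lifted_observer_field_def \<sigma>\<tau> der(3)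
            matrix_vector_mul_assoc)
    qed
    then have "\<tau>e (Z' t) = \<Xi> t"
      using uniq[of "\<lambda>s. \<tau>e (Z' s)" T t] Z'0 solX t by simp
    then show ?thesis using \<sigma>\<tau> Z' t by metis
  qed
  ultimately show ?thesis
    unfolding global_cascade_solution_def solves_cascade_iff
    using sol \<Xi>0 \<sigma>\<tau> \<sigma>_in \<open>z0 \<in> Oa\<close> by auto
qed

theorem proposition1p1:
  fixes f :: "real^'n \<Rightarrow> real^'n"
    and h :: "real^'n \<Rightarrow> real^'q"
    and A Op :: "(real^'n) set"
    and \<tau>s :: "real^'n \<Rightarrow> real^'m"
    and \<T> :: "(((real^'m) \<times> (real^'n) \<times> (real^'q) \<Rightarrow> real^'m) \<times> (real^'m \<Rightarrow> real^'n)) set"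
    and e :: "'n \<Rightarrow> 'm"
    and Oa :: "(real^'m) set"
    and \<tau>e :: "real^'m \<Rightarrow> real^'m"
    and \<phi> :: "(real^'m) \<times> (real^'n) \<times> (real^'q) \<Rightarrow> real^'m"
    and x0 :: "real^'n"
    and X :: "real \<Rightarrow> real^'n"
    and z0 :: "real^'m"
  assumes "inj e"
    and "bounded A"
    and "converging_observer f h A Op \<tau>s \<T>"
    and "open Oa"
    and "closure (x_embed e ` A) \<subseteq> Oa"
    and "C1_diffeo_onto_image Oa \<tau>e"
    and "\<forall>x\<in>A. \<tau>e (x_embed e x) = \<tau>s x"
    and "\<tau>e ` Oa = UNIV"
    and "(\<phi>, \<lambda>\<xi>. x_part e (the_inv_into Oa \<tau>e \<xi>)) \<in> \<T>"
    and "x0 \<in> A"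
    and "X 0 = x0"
    and "solves f UNIV {0..} X"
    and "\<forall>t\<ge>0. X t \<in> A"
    and "z0 \<in> Oa"
  shows "\<exists>Z. global_cascade_solution f (lifted_observer_field e h \<phi> \<tau>e) Oa X z0 Z \<and>
           ((\<lambda>t. norm (w_part e (Z t)) + norm (X t - x_part e (Z t))) \<longlongrightarrow> 0) at_top"
proof -
  define \<sigma> where "\<sigma> = the_inv_into Oa \<tau>e"
  have inj: "inj_on \<tau>e Oa" and C1: "C1_on Oa \<tau>e" "C1_on UNIV \<sigma>"
    using assms(6,8) by (simp_all add: C1_diffeo_onto_image_def \<sigma>_def)
  have \<sigma>\<tau>: "\<sigma> (\<tau>e z) = z" if "z \<in> Oa" for z
    unfolding \<sigma>_def by (rule the_inv_into_f_f[OF inj that])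
  obtain \<Xi> where
    \<Xi>: "global_cascade_solution f (observer_field h \<phi> (\<lambda>\<xi>. x_part e (\<sigma> \<xi>))) UNIV X (\<tau>e z0) \<Xi>"
    and lim: "((\<lambda>t. norm (\<Xi> t - \<tau>s (X t))) \<longlongrightarrow> 0) at_top"
    using assms(3,9-13) unfolding converging_observer_def \<sigma>_def by blast
  let ?C = "closure (x_embed e ` A)"
  have in_C: "x_embed e x \<in> ?C" if "x \<in> A" for x
    using that closure_subset[of "x_embed e ` A"] by auto
  have "continuous_on Oa \<tau>e" "continuous_on UNIV \<sigma>"
    using C1 by (simp_all add: C1_on_imp_continuous_on)
  \<comment> \<open>\<open>A\<close> is only bounded; passing to the closure gives a compact set,
    still inside \<open>Oa\<close>, where \<open>\<tau>e\<close> is continuous.\<close>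
  moreover have "compact ?C"
    using bounded_linear_image[OF \<open>bounded A\<close> bounded_linear_x_embed] by simp
  ultimately have "compact (\<tau>e ` ?C)"
    using assms(5) by (blast intro: compact_continuous_image continuous_on_subset)
  \<comment> \<open>Stated eventually because \<open>X t\<close> is known to lie in \<open>A\<close>
    only for \<open>t \<ge> 0\<close>.\<close>
  moreover have "\<forall>\<^sub>F t in at_top. \<tau>s (X t) \<in> \<tau>e ` ?C"
    using eventually_ge_at_top[of 0]
  proof eventually_elim
    case (elim t)
    then show ?case
      using assms(7,13) imageI[OF in_C, of "X t" \<tau>e] by simp
  qed
  ultimately have "((\<lambda>t. \<sigma> (\<Xi> t) - \<sigma> (\<tau>s (X t))) \<longlongrightarrow> 0) at_top"
    using tendsto_compose_diff_compact[OF \<open>continuous_on UNIV \<sigma>\<close> _ _ lim] by blast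
  \<comment> \<open>On \<open>A\<close> the map \<open>\<tau>s\<close> is \<open>\<tau>e\<close>
    after \<open>x_embed e\<close>, and \<open>\<sigma>\<close> undoes \<open>\<tau>e\<close> on
    \<open>Oa\<close>.\<close>
  moreover have "\<forall>\<^sub>F t in at_top. \<sigma> (\<Xi> t) - \<sigma> (\<tau>s (X t)) = \<sigma> (\<Xi> t) - x_embed e (X t)"
    using eventually_ge_at_top[of 0]
  proof eventually_elim
    case (elim t)
    then show ?case
      using assms(7,13) \<sigma>\<tau>[OF subsetD[OF assms(5) in_C], of "X t"] by simp
  qed
  ultimately have "((\<lambda>t. \<sigma> (\<Xi> t) - x_embed e (X t)) \<longlongrightarrow> 0) at_top"
    by (rule Lim_transform_eventually)
  \<comment> \<open>Both coordinate projections are bounded linear, so each preserves convergence to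
    0. The embedded \<open>X t\<close> has zero w-part and x-part \<open>X t\<close>, which yields
    the claimed sum.\<close>
  then have "((\<lambda>t. norm (w_part e (\<sigma> (\<Xi> t) - x_embed e (X t))) +
      norm (x_part e (\<sigma> (\<Xi> t) - x_embed e (X t)))) \<longlongrightarrow> 0) at_top"
    by (intro tendsto_add_zero tendsto_norm_zero
        bounded_linear.tendsto_zero[OF bounded_linear_w_part]
        bounded_linear.tendsto_zero[OF bounded_linear_x_part])
  then have "((\<lambda>t. norm (w_part e (\<sigma> (\<Xi> t))) + norm (X t - x_part e (\<sigma> (\<Xi> t)))) \<longlongrightarrow> 0) at_top"
    by (simp add: linear_diff[OF bounded_linear.linear, OF bounded_linear_w_part] w_part_x_embed norm_minus_commute
        linear_diff[OF bounded_linear.linear, OF bounded_linear_x_part] x_part_x_embed[OF \<open>inj e\<close>])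
  with global_cascade_solution_pullback[OF assms(4,6,8,14) \<Xi>[unfolded \<sigma>_def]]
  show ?thesis unfolding \<sigma>_def by blast
qed

end
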